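(* Let $D\subset\mathbb{R}^2$ be a bounded region with analytic boundary $\partial D$. If $k\in\mathbb{C}_+$ is a transmission eigenvalue (of the clamped transmission eigenvalue problem for $D$), then $k$ is real-valued.
   Context: Let $\mathbb{C}_+ := \{z\in\mathbb{C} : \mathrm{Re}(z)>0 \text{ and } \mathrm{Re}(z^2)>0\}$. Let $\nu$ denote the outward unit normal vector on $\partial D$, and let $X(D)$ be the complex Hilbert space $$X(D)=\{(v,w)\in H^1(D)\times H^1(\mathbb{R}^2\setminus\overline{D}) : (v+w)|_{\partial D}=0\}$$ with the standard product inner product (boundary values are traces). A number $k\in\mathbb{C}_+$ is called a (clamped) transmission eigenvalue if there exists a nontrivial pair $(v,w)\in X(D)$ such that $$\Delta v+k^2v=0 \ \text{ in } D,\qquad \Delta w-k^2w=0\ \text{ in } \mathbb{R}^2\setminus\overline{D},$$ $$v+w=0,\quad \partial_\nu(v+w)=0\ \text{ on }\partial D,\qquad \lim_{r\to\infty}\sqrt{r}\,(\partial_r w-\mathrm{i}kw)=0,\quad r=|x|,$$ where the equations are understood in the weak sense, the normal derivatives in the sense of $H^{-1/2}(\partial D)$, and the radiation condition is uniform in $x/|x|$. (For $k\in\mathbb{C}_+$ and $w\in H^1(\mathbb{R}^2\setminus\overline D)$ the radiation condition is redundant.) Equivalently, $(v,w)\in X(D)\setminus\{0\}$ satisfies $$\int_D \nabla v\cdot\nabla\overline{\psi_1}\,dx+\int_{\mathbb{R}^2\setminus\overline D}\nabla w\cdot\nabla\overline{\psi_2}+k^2w\overline{\psi_2}\,dx-k^2\int_D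 v\overline{\psi_1}\,dx=0\quad\text{for all }(\psi_1,\psi_2)\in X(D).$$ *)

theory Defs
  imports "HOL-Analysis.Analysis"
begin

section \<open>Planar regions with analytic boundary\<close>

definition real_analytic_on :: "real set \<Rightarrow> (real \<Rightarrow> real) \<Rightarrow> bool" where
  "real_analytic_on S h \<longleftrightarrow>
     (\<forall>t0\<in>S. \<exists>a r. r > 0 \<and> (\<forall>t. \<bar>t - t0\<bar> < r \<longrightarrow> (\<lambda>n. a n * (t - t0) ^ n) sums h t))"

text \<open>Near each boundary point, in suitable Cartesian coordinates centred there, the set is
  the region strictly above the graph of a real-analytic function.\<close>
definition analytic_boundary :: "(real^2) set \<Rightarrow> bool" where
  "analytic_boundary D \<longleftrightarrow>
     (\<forall>p\<in>frontier D. \<exists>r>0. \<exists>e1 e2 h.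
        norm e1 = 1 \<and> norm e2 = 1 \<and> e1 \<bullet> e2 = 0 \<and>
        real_analytic_on {-r<..<r} h \<and>
        D \<inter> ball p r = {x \<in> ball p r. h ((x - p) \<bullet> e1) < (x - p) \<bullet> e2})"

definition bounded_analytic_region :: "(real^2) set \<Rightarrow> bool" where
  "bounded_analytic_region D \<longleftrightarrow>
     D \<noteq> {} \<and> open D \<and> connected D \<and> bounded D \<and> analytic_boundary D"


section \<open>Test functions and the Sobolev space $H^1$\<close>

definition partial_deriv :: "2 \<Rightarrow> (real^2 \<Rightarrow> complex) \<Rightarrow> real^2 \<Rightarrow> complex" where
  "partial_deriv i f x = frechet_derivative f (at x) (axis i 1)"

primrec is_Ck :: "nat \<Rightarrow> (real^2 \<Rightarrow> complex) \<Rightarrow> bool" where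
  "is_Ck 0 f \<longleftrightarrow> continuous_on UNIV f"
| "is_Ck (Suc n) f \<longleftrightarrow> (\<forall>x. f differentiable (at x)) \<and> (\<forall>i. is_Ck n (partial_deriv i f))"

text \<open>The space $C_c^\infty(\Omega)$, its elements being extended by zero to the plane.\<close>
definition test_fun :: "(real^2) set \<Rightarrow> (real^2 \<Rightarrow> complex) set" where
  "test_fun \<Omega> = {\<phi>. (\<forall>n. is_Ck n \<phi>) \<and> compact (closure {x. \<phi> x \<noteq> 0}) \<and>
                     closure {x. \<phi> x \<noteq> 0} \<subseteq> \<Omega>}"

text \<open>Elements of $L^2(\Omega)$ and $H^1(\Omega)$ are represented by total functions, of which
  only the values almost everywhere on \<open>\<Omega>\<close> matter.\<close>
definition L2 :: "(real^2) set \<Rightarrow> (real^2 \<Rightarrow> complex) set" where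
  "L2 \<Omega> = {u. u \<in> borel_measurable (lebesgue_on \<Omega>) \<and>
               integrable (lebesgue_on \<Omega>) (\<lambda>x. (cmod (u x))\<^sup>2)}"

definition is_weak_partial ::
  "(real^2) set \<Rightarrow> 2 \<Rightarrow> (real^2 \<Rightarrow> complex) \<Rightarrow> (real^2 \<Rightarrow> complex) \<Rightarrow> bool" where
  "is_weak_partial \<Omega> i u g \<longleftrightarrow>
     (\<forall>\<phi>\<in>test_fun \<Omega>. (LINT x|lebesgue_on \<Omega>. u x * partial_deriv i \<phi> x)
                     = - (LINT x|lebesgue_on \<Omega>. g x * \<phi> x))"

definition H1 :: "(real^2) set \<Rightarrow> (real^2 \<Rightarrow> complex) set" where
  "H1 \<Omega> = {u \<in> L2 \<Omega>. \<forall>i. \<exists>g\<in>L2 \<Omega>. is_weak_partial \<Omega> i u g}"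

text \<open>A representative of the weak partial derivative; it is unique up to null sets, and all
  uses below are under integrals.\<close>
definition wpartial :: "(real^2) set \<Rightarrow> 2 \<Rightarrow> (real^2 \<Rightarrow> complex) \<Rightarrow> real^2 \<Rightarrow> complex" where
  "wpartial \<Omega> i u = (SOME g. g \<in> L2 \<Omega> \<and> is_weak_partial \<Omega> i u g)"

definition grad_inner ::
  "(real^2) set \<Rightarrow> (real^2 \<Rightarrow> complex) \<Rightarrow> (real^2 \<Rightarrow> complex) \<Rightarrow> complex" where
  "grad_inner \<Omega> u \<psi> =
     (LINT x|lebesgue_on \<Omega>. (\<Sum>i\<in>UNIV. wpartial \<Omega> i u x * cnj (wpartial \<Omega> i \<psi> x)))"

definition l2_inner ::
  "(real^2) set \<Rightarrow> (real^2 \<Rightarrow> complex) \<Rightarrow> (real^2 \<Rightarrow> complex) \<Rightarrow> complex" where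
  "l2_inner \<Omega> u \<psi> = (LINT x|lebesgue_on \<Omega>. u x * cnj (\<psi> x))"

text \<open>$\Delta u = f$ weakly in \<open>\<Omega>\<close>.\<close>
definition has_weak_laplacian ::
  "(real^2) set \<Rightarrow> (real^2 \<Rightarrow> complex) \<Rightarrow> (real^2 \<Rightarrow> complex) \<Rightarrow> bool" where
  "has_weak_laplacian \<Omega> u f \<longleftrightarrow> u \<in> H1 \<Omega> \<and> f \<in> L2 \<Omega> \<and>
     (\<forall>\<phi>\<in>test_fun \<Omega>.
        (LINT x|lebesgue_on \<Omega>. (\<Sum>i\<in>UNIV. wpartial \<Omega> i u x * partial_deriv i \<phi> x))
          = - (LINT x|lebesgue_on \<Omega>. f x * \<phi> x))"


section \<open>Traces and normal derivatives\<close>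

text \<open>One-dimensional Hausdorff outer measure. It is a metric outer measure, so it is
  countably additive on Borel sets (as \<^const>\<open>measure_of\<close> requires), and on regular curves it
  is arc length.\<close>
definition hausdorff1 :: "(real^2) set \<Rightarrow> ennreal" where
  "hausdorff1 A =
     (SUP \<delta>\<in>{0<..}. INF U\<in>{U :: nat \<Rightarrow> (real^2) set. A \<subseteq> (\<Union>n. U n) \<and>
                                (\<forall>n. bounded (U n) \<and> diameter (U n) \<le> \<delta>)}.
        \<Sum>n. ennreal (diameter (U n)))"

definition arclength_on :: "(real^2) set \<Rightarrow> (real^2) measure" where
  "arclength_on \<Gamma> = restrict_space (measure_of UNIV (sets borel) hausdorff1) \<Gamma>"

text \<open>\<open>g\<close> is the trace of \<open>u \<in> H1 \<Omega>\<close> on the boundary \<open>\<Gamma>\<close> of \<open>\<Omega>\<close>: the trace operator is the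
  continuous extension to $H^1(\Omega)$, with values in $L^2(\Gamma)$, of the restriction to \<open>\<Gamma>\<close> of
  functions in $C_c^\infty(\mathbb{R}^2)$, which are dense in $H^1(\Omega)$.\<close>
definition has_trace ::
  "(real^2) set \<Rightarrow> (real^2) set \<Rightarrow> (real^2 \<Rightarrow> complex) \<Rightarrow> (real^2 \<Rightarrow> complex) \<Rightarrow> bool" where
  "has_trace \<Omega> \<Gamma> u g \<longleftrightarrow>
     u \<in> H1 \<Omega> \<and>
     g \<in> borel_measurable (arclength_on \<Gamma>) \<and>
     integrable (arclength_on \<Gamma>) (\<lambda>y. (cmod (g y))\<^sup>2) \<and>
     (\<exists>\<phi>. (\<forall>n. \<phi> n \<in> test_fun UNIV) \<and>
        (\<lambda>n. LINT x|lebesgue_on \<Omega>. (cmod (\<phi> n x - u x))\<^sup>2) \<longlonglongrightarrow> 0 \<and>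
        (\<forall>i. (\<lambda>n. LINT x|lebesgue_on \<Omega>. (cmod (partial_deriv i (\<phi> n) x - wpartial \<Omega> i u x))\<^sup>2)
               \<longlonglongrightarrow> 0) \<and>
        (\<lambda>n. LINT y|arclength_on \<Gamma>. (cmod (\<phi> n y - g y))\<^sup>2) \<longlonglongrightarrow> 0)"

text \<open>\<open>N\<close> is the normal derivative of \<open>u\<close> on \<open>\<Gamma>\<close> in the sense of $H^{-1/2}(\Gamma)$, for the unit
  normal pointing out of \<open>\<Omega>\<close>, where $\Delta u = f$ in \<open>\<Omega>\<close>. It acts antilinearly on
  $H^{1/2}(\Gamma)$, the space of traces, by Green's formula
  $\langle \partial_\nu u, \psi|_\Gamma\rangle =
    \int_\Omega \nabla u\cdot\nabla\overline\psi + \Delta u\,\overline\psi$;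
  this determines \<open>N\<close> there and makes it bounded.\<close>
definition has_normal_derivative ::
  "(real^2) set \<Rightarrow> (real^2) set \<Rightarrow> (real^2 \<Rightarrow> complex) \<Rightarrow> (real^2 \<Rightarrow> complex)
     \<Rightarrow> ((real^2 \<Rightarrow> complex) \<Rightarrow> complex) \<Rightarrow> bool" where
  "has_normal_derivative \<Omega> \<Gamma> u f N \<longleftrightarrow>
     has_weak_laplacian \<Omega> u f \<and>
     (\<forall>\<psi> g. has_trace \<Omega> \<Gamma> \<psi> g \<longrightarrow> N g = grad_inner \<Omega> u \<psi> + l2_inner \<Omega> f \<psi>)"


section \<open>Clamped transmission eigenvalues\<close>

definition C_plus :: "complex set" where
  "C_plus = {z. Re z > 0 \<and> Re (z\<^sup>2) > 0}"

abbreviation exterior_of :: "(real^2) set \<Rightarrow> (real^2) set" where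
  "exterior_of D \<equiv> - closure D"

definition X_space :: "(real^2) set \<Rightarrow> ((real^2 \<Rightarrow> complex) \<times> (real^2 \<Rightarrow> complex)) set" where
  "X_space D = {(v, w). v \<in> H1 D \<and> w \<in> H1 (exterior_of D) \<and>
     (\<exists>g h. has_trace D (frontier D) v g \<and> has_trace (exterior_of D) (frontier D) w h \<and>
            (AE y in arclength_on (frontier D). g y + h y = 0))}"

text \<open>The radiation condition concerns the smooth representative of \<open>w\<close> (which exists by
  elliptic regularity); the radial limit is uniform over the directions \<open>\<theta>\<close>.\<close>
definition radiating :: "(real^2) set \<Rightarrow> complex \<Rightarrow> (real^2 \<Rightarrow> complex) \<Rightarrow> bool" where
  "radiating \<Omega> k w \<longleftrightarrow>
     (\<exists>w'. (AE x in lebesgue_on \<Omega>. w' x = w x) \<and> (\<forall>x\<in>\<Omega>. w' differentiable (at x)) \<and>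
        uniform_limit (sphere 0 1)
          (\<lambda>r \<theta>. complex_of_real (sqrt r) *
             (frechet_derivative w' (at (r *\<^sub>R \<theta>)) \<theta> - \<i> * k * w' (r *\<^sub>R \<theta>)))
          (\<lambda>_. 0) at_top)"

text \<open>The normal on the boundary points out of \<open>D\<close>, hence into the exterior; this is the
  reason for the minus sign in front of \<open>Nw\<close>.\<close>
definition transmission_eigenvalue :: "(real^2) set \<Rightarrow> complex \<Rightarrow> bool" where
  "transmission_eigenvalue D k \<longleftrightarrow> k \<in> C_plus \<and>
     (\<exists>v w. (v, w) \<in> X_space D \<and>
        \<not> ((AE x in lebesgue_on D. v x = 0) \<and> (AE x in lebesgue_on (exterior_of D). w x = 0)) \<and>
        has_weak_laplacian D v (\<lambda>x. - k\<^sup>2 * v x) \<and>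
        has_weak_laplacian (exterior_of D) w (\<lambda>x. k\<^sup>2 * w x) \<and>
        (\<exists>Nv Nw. has_normal_derivative D (frontier D) v (\<lambda>x. - k\<^sup>2 * v x) Nv \<and>
           has_normal_derivative (exterior_of D) (frontier D) w (\<lambda>x. k\<^sup>2 * w x) Nw \<and>
           (\<forall>\<psi> g. has_trace D (frontier D) \<psi> g \<longrightarrow> Nv g + (- Nw g) = 0)) \<and>
        radiating (exterior_of D) k w)"

end

theory Submission
  imports Defs
begin

text \<open>The eigenpair itself is an admissible test pair. Since \<open>v + w\<close> vanishes on the boundary,
the boundary values \<open>g\<close> of \<open>v\<close> are also the trace of \<open>- w\<close> from outside, so the two normal
derivatives, which agree, can both be evaluated at \<open>g\<close> by Green's formula. This gives
$$\|\nabla v\|^2 + \|\nabla w\|^2 = k^2 (\|v\|^2 - \|w\|^2),$$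
where the left side is the sum of two values of \<open>dirichlet_energy\<close>. If \<open>k\<close> is not real, then,
as its real part is positive, $k^2$ is not real either. The imaginary part of the identity
forces $\|v\| = \|w\|$, hence both gradients vanish. Then both Laplacians $-k^2 v$ and $k^2 w$
vanish as well (\<open>laplacian_0_if_dirichlet_energy_0\<close>), and the pair is trivial.

The argument needs one analytic tool, the fundamental lemma of the calculus of variations.
It makes weak derivatives unique, so that the chosen representatives \<open>wpartial\<close> commute with
the sign change from \<open>w\<close> to \<open>- w\<close>, and it turns a vanishing weak Laplacian into a vanishing
function. The lemma rests on an explicit supply of test functions: indicators of open sets are
bounded pointwise limits of test functions (\<open>smooth_approximation_of_open_set\<close>). A function
orthogonal to all test functions therefore has integral zero over bounded open sets, then over compact
sets, and so it vanishes almost everywhere.\<close>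

section \<open>Smooth functions built from exponentials\<close>

text \<open>For \<open>k = 0\<close> this is the classical smooth function that is positive exactly on the positive
half-line. The powers of \<open>1 / t\<close> are included because derivatives produce them.\<close>
definition flat :: "nat \<Rightarrow> real \<Rightarrow> real" where
  "flat k t = (if t > 0 then inverse t ^ k * exp (- inverse t) else 0)"

lemma flat_0_bounds: "0 \<le> flat 0 t" "flat 0 t < 1" "0 < flat 0 t \<longleftrightarrow> 0 < t"
  by (auto simp: flat_def)

text \<open>Substituting \<open>x = 1 / t\<close> on the right of \<open>0\<close>, this is the fact that \<open>exp x\<close> outgrows every power
of \<open>x\<close>.\<close>
lemma flat_tendsto_0: "(flat k \<longlongrightarrow> 0) (at 0)"
proof -
  have "((\<lambda>t. flat k t) \<longlongrightarrow> 0) (at_right 0)"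
  proof -
    have "((\<lambda>x. x ^ k / exp x) \<longlongrightarrow> (0::real)) at_top"
      by (rule tendsto_power_div_exp_0)
    moreover have "eventually (\<lambda>x. x ^ k / exp x = flat k (inverse x)) (at_top :: real filter)"
      using eventually_gt_at_top[of 0]
      by eventually_elim (simp add: flat_def exp_minus field_simps)
    ultimately have "((\<lambda>x. flat k (inverse x)) \<longlongrightarrow> 0) at_top"
      by (rule Lim_transform_eventually)
    thus ?thesis
      by (subst filterlim_at_right_to_top)
  qed
  moreover have "((\<lambda>t. flat k t) \<longlongrightarrow> 0) (at_left 0)"
    by (rule Lim_transform_eventually[OF tendsto_const])
      (auto simp: flat_def eventually_at_filter)
  ultimately show ?thesis
    by (simp add: filterlim_at_split)
qed

text \<open>The derivative is again a combination of functions of the same family, which is why the whole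
family is infinitely differentiable. At \<open>0\<close> the difference quotient of \<open>flat k\<close> equals
\<open>flat (Suc k)\<close>, which tends to \<open>0\<close>.\<close>
lemma flat_has_derivative:
  "(flat k has_real_derivative (flat (k + 2) t - real k * flat (k + 1) t)) (at t)"
proof -
  consider "t > 0" | "t < 0" | "t = 0" by linarith
  thus ?thesis
  proof cases
    case 1
    have "((\<lambda>t. inverse t ^ k) has_real_derivative - (real k * inverse t ^ (k + 1))) (at t)"
      using DERIV_power[OF DERIV_inverse[of t UNIV], of k] 1
      by (cases k) (simp_all add: mult_ac)
    moreover have "((\<lambda>t. exp (- inverse t)) has_real_derivative
        exp (- inverse t) * inverse t ^ 2) (at t)"
      using 1 by (auto intro!: derivative_eq_intros simp: power2_eq_square)
    ultimately have "((\<lambda>t. inverse t ^ k * exp (- inverse t)) has_real_derivative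
        - (real k * inverse t ^ (k + 1)) * exp (- inverse t) +
        exp (- inverse t) * inverse t ^ 2 * inverse t ^ k) (at t)"
      by (rule DERIV_mult)
    hence "((\<lambda>t. inverse t ^ k * exp (- inverse t)) has_real_derivative
            (flat (k + 2) t - real k * flat (k + 1) t)) (at t)"
      using 1 by (simp add: flat_def power2_eq_square algebra_simps)
    thus ?thesis
      by (rule has_field_derivative_transform_within_open[where S = "{0<..}"])
        (use 1 in \<open>auto simp: flat_def\<close>)
  next
    case 2
    have "((\<lambda>t. 0) has_real_derivative (flat (k + 2) t - real k * flat (k + 1) t)) (at t)"
      using 2 by (auto simp: flat_def)
    thus ?thesis
      by (rule has_field_derivative_transform_within_open[where S = "{..<0}"])
        (use 2 in \<open>auto simp: flat_def\<close>)
  next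
    case 3
    have "((\<lambda>h. (flat k (0 + h) - flat k 0) / h) \<longlongrightarrow> 0) (at 0)"
      by (rule Lim_transform_eventually[OF flat_tendsto_0[of "Suc k"]])
        (auto simp: flat_def eventually_at_filter field_simps)
    thus ?thesis
      using 3 by (simp add: DERIV_def flat_def)
  qed
qed

text \<open>A class of functions on the plane that is closed under partial differentiation and consists of
differentiable functions contains only smooth functions. Sums and products are included so that
the Leibniz rule and the constructions of bumps below stay inside the class.\<close>
inductive_set flat_algebra :: "(real^2 \<Rightarrow> complex) set" where
  const: "(\<lambda>x. c) \<in> flat_algebra"
| flat: "(\<lambda>x. complex_of_real (flat k (c + s * x $ i))) \<in> flat_algebra"
| add: "f \<in> flat_algebra \<Longrightarrow> g \<in> flat_algebra \<Longrightarrow> (\<lambda>x. f x + g x) \<in> flat_algebra"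
| mult: "f \<in> flat_algebra \<Longrightarrow> g \<in> flat_algebra \<Longrightarrow> (\<lambda>x. f x * g x) \<in> flat_algebra"

lemma flat_algebra_power: "f \<in> flat_algebra \<Longrightarrow> (\<lambda>x. f x ^ n) \<in> flat_algebra"
  by (induction n) (auto intro: flat_algebra.intros)

lemma flat_algebra_diff:
  assumes "f \<in> flat_algebra" "g \<in> flat_algebra"
  shows "(\<lambda>x. f x - g x) \<in> flat_algebra"
  using flat_algebra.add[OF assms(1) flat_algebra.mult[OF flat_algebra.const[of "-1"] assms(2)]]
  by simp

lemma flat_algebra_prod:
  assumes "\<And>j. j \<in> J \<Longrightarrow> f j \<in> flat_algebra"
  shows "(\<lambda>x. \<Prod>j\<in>J. f j x) \<in> flat_algebra"
  using assms by (induction J rule: infinite_finite_induct) (auto intro: flat_algebra.intros)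

lemma flat_algebra_gradient:
  "f \<in> flat_algebra \<Longrightarrow>
     \<exists>g. (\<forall>i. g i \<in> flat_algebra) \<and>
         (\<forall>x. (f has_derivative (\<lambda>h. \<Sum>i\<in>UNIV. h $ i *\<^sub>R g i x)) (at x))"
proof (induction rule: flat_algebra.induct)
  case (const c)
  show ?case
    by (rule exI[of _ "\<lambda>i x. 0"]) (auto intro: flat_algebra.const)
next
  case (flat k c s i)
  let ?d = "\<lambda>t. flat (k + 2) t - real k * flat (k + 1) t"
  let ?g = "\<lambda>j x. (if j = i then complex_of_real s else 0) *
     (complex_of_real (flat (k + 2) (c + s * x $ i)) -
      complex_of_real (real k) * complex_of_real (flat (k + 1) (c + s * x $ i)))"
  have "?g j \<in> flat_algebra" for j
    by (intro flat_algebra.mult flat_algebra_diff flat_algebra.const flat_algebra.flat)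
  moreover have "((\<lambda>x. complex_of_real (flat k (c + s * x $ i))) has_derivative
      (\<lambda>h. \<Sum>j\<in>UNIV. h $ j *\<^sub>R ?g j x)) (at x)" for x :: "real^2"
  proof -
    have "((\<lambda>x. c + s * x $ i) has_derivative (\<lambda>h. s * h $ i)) (at x)"
      by (auto intro!: derivative_eq_intros bounded_linear_imp_has_derivative
          bounded_linear_vec_nth)
    moreover have "(flat k has_derivative (\<lambda>y. ?d (c + s * x $ i) * y)) (at (c + s * x $ i))"
      using flat_has_derivative[of k "c + s * x $ i"] by (simp add: has_field_derivative_def)
    ultimately have "((\<lambda>x. flat k (c + s * x $ i)) has_derivative
        (\<lambda>h. ?d (c + s * x $ i) * (s * h $ i))) (at x)"
      using has_derivative_compose by fast
    hence "((\<lambda>x. complex_of_real (flat k (c + s * x $ i))) has_derivative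
        (\<lambda>h. complex_of_real (?d (c + s * x $ i) * (s * h $ i)))) (at x)"
      by (rule has_derivative_of_real)
    moreover have "complex_of_real (?d (c + s * x $ i) * (s * h $ i)) =
        (\<Sum>j\<in>UNIV. h $ j *\<^sub>R ?g j x)" for h
    proof -
      have "(\<Sum>j\<in>UNIV. h $ j *\<^sub>R ?g j x) = (\<Sum>j\<in>UNIV. if j = i then h $ j *\<^sub>R ?g i x else 0)"
        by (intro sum.cong) auto
      also have "\<dots> = h $ i *\<^sub>R ?g i x"
        by simp
      finally show ?thesis
        by (simp add: scaleR_conv_of_real algebra_simps)
    qed
    ultimately show ?thesis
      by simp
  qed
  ultimately show ?case
    by (intro exI[of _ ?g]) blast
next
  case (add f1 f2)
  then obtain g1 g2 where
    "\<forall>i. g1 i \<in> flat_algebra" "\<forall>i. g2 i \<in> flat_algebra"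
    "\<forall>x. (f1 has_derivative (\<lambda>h. \<Sum>i\<in>UNIV. h $ i *\<^sub>R g1 i x)) (at x)"
    "\<forall>x. (f2 has_derivative (\<lambda>h. \<Sum>i\<in>UNIV. h $ i *\<^sub>R g2 i x)) (at x)"
    by blast
  thus ?case
    by (intro exI[of _ "\<lambda>i x. g1 i x + g2 i x"])
      (auto intro!: flat_algebra.intros derivative_eq_intros
        simp: scaleR_add_right sum.distrib)
next
  case (mult f1 f2)
  then obtain g1 g2 where g:
    "\<forall>i. g1 i \<in> flat_algebra" "\<forall>i. g2 i \<in> flat_algebra"
    "\<forall>x. (f1 has_derivative (\<lambda>h. \<Sum>i\<in>UNIV. h $ i *\<^sub>R g1 i x)) (at x)"
    "\<forall>x. (f2 has_derivative (\<lambda>h. \<Sum>i\<in>UNIV. h $ i *\<^sub>R g2 i x)) (at x)"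
    by blast
  have "((\<lambda>x. f1 x * f2 x) has_derivative
      (\<lambda>h. \<Sum>i\<in>UNIV. h $ i *\<^sub>R (f1 x * g2 i x + g1 i x * f2 x))) (at x)" for x
  proof -
    have "((\<lambda>x. f1 x * f2 x) has_derivative
      (\<lambda>h. f1 x * (\<Sum>i\<in>UNIV. h $ i *\<^sub>R g2 i x) + (\<Sum>i\<in>UNIV. h $ i *\<^sub>R g1 i x) * f2 x)) (at x)"
      using g by (intro has_derivative_mult) auto
    thus ?thesis
      by (simp add: sum_distrib_left sum_distrib_right scaleR_add_right sum.distrib)
  qed
  with g mult.hyps show ?case
    by (intro exI[of _ "\<lambda>i x. f1 x * g2 i x + g1 i x * f2 x"])
      (auto intro!: flat_algebra.intros)
qed

lemma flat_algebra_is_Ck: "f \<in> flat_algebra \<Longrightarrow> is_Ck n f"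
proof (induction n arbitrary: f)
  case 0
  then obtain f' where "\<forall>x. (f has_derivative f' x) (at x)"
    using flat_algebra_gradient[of f] by meson
  hence "\<forall>x. f differentiable (at x)"
    by (auto simp: differentiable_def)
  thus ?case
    by (auto intro: differentiable_imp_continuous_on simp: differentiable_on_def)
next
  case (Suc n)
  obtain g where g: "\<forall>i. g i \<in> flat_algebra"
    "\<forall>x. (f has_derivative (\<lambda>h. \<Sum>i\<in>UNIV. h $ i *\<^sub>R g i x)) (at x)"
    using flat_algebra_gradient[OF Suc.prems] by blast
  have "partial_deriv i f x = g i x" for i x
  proof -
    have "partial_deriv i f x = (\<Sum>j\<in>UNIV. axis i (1::real) $ j *\<^sub>R g j x)"
      unfolding partial_deriv_def frechet_derivative_at[OF g(2)[rule_format], symmetric] ..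
    also have "\<dots> = (\<Sum>j\<in>UNIV. if j = i then g j x else 0)"
      by (intro sum.cong) (auto simp: axis_def)
    finally show ?thesis by simp
  qed
  hence "partial_deriv i f = g i" for i by blast
  thus ?case
    using Suc.IH g by (auto simp: differentiable_def)
qed

section \<open>Smooth approximation of indicator functions\<close>

text \<open>The factors are written in the form \<open>c + s * x $ i\<close> that the generators of \<open>flat_algebra\<close> have.\<close>
definition box_bump :: "(real^2) \<times> (real^2) \<Rightarrow> real^2 \<Rightarrow> real" where
  "box_bump ab x =
     (\<Prod>i\<in>UNIV. flat 0 (- fst ab $ i + 1 * x $ i) * flat 0 (snd ab $ i + (-1) * x $ i))"

lemma box_bump_flat_algebra: "(\<lambda>x. complex_of_real (box_bump ab x)) \<in> flat_algebra"
  unfolding box_bump_def of_real_prod of_real_mult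
  by (intro flat_algebra_prod flat_algebra.mult flat_algebra.flat)

lemma box_bump_bounds:
  "0 \<le> box_bump ab x" "box_bump ab x \<le> 1"
  "x \<in> box (fst ab) (snd ab) \<Longrightarrow> 0 < box_bump ab x"
  "x \<notin> box (fst ab) (snd ab) \<Longrightarrow> box_bump ab x = 0"
proof -
  show "0 \<le> box_bump ab x"
    by (auto simp: box_bump_def flat_0_bounds intro!: prod_nonneg mult_nonneg_nonneg)
  show "box_bump ab x \<le> 1"
    unfolding box_bump_def
    by (intro prod_le_1 conjI mult_le_one mult_nonneg_nonneg flat_0_bounds less_imp_le[OF flat_0_bounds(2)])
  show "0 < box_bump ab x" if "x \<in> box (fst ab) (snd ab)"
    using that unfolding box_bump_def
    by (intro prod_pos) (auto simp: mem_box_cart flat_0_bounds)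
  show "box_bump ab x = 0" if "x \<notin> box (fst ab) (snd ab)"
    using that unfolding box_bump_def mem_box_cart
    by (subst prod_zero_iff) (auto simp: flat_def)
qed

text \<open>The closed boxes stay inside \<open>U\<close>, so that a bump on an open box has compact support in \<open>U\<close>.\<close>
lemma open_Union_boxes:
  fixes U :: "(real^2) set"
  assumes "open U"
  obtains ab :: "nat \<Rightarrow> (real^2) \<times> (real^2)" where
    "\<And>n. cbox (fst (ab n)) (snd (ab n)) \<subseteq> U"
    "U = (\<Union>n. box (fst (ab n)) (snd (ab n)))"
proof -
  define I where "I = {p :: (real^2) \<times> (real^2). cbox (fst p) (snd p) \<subseteq> U}"
  have U: "(\<Union>p\<in>I. box (fst p) (snd p)) = U"
  proof safe
    fix x assume "x \<in> U"
    then obtain e where e: "e > 0" "cball x e \<subseteq> U"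
      using assms open_contains_cball by blast
    obtain a b where "x \<in> box a b" "box a b \<subseteq> ball x e"
      using rational_boxes[OF e(1), of x] by metis
    moreover from this have "cbox a b \<subseteq> cball x e"
      using closure_mono[of "box a b" "ball x e"] e(1)
      by (metis box_ne_empty(2) closure_ball closure_box empty_iff)
    ultimately show "x \<in> (\<Union>p\<in>I. box (fst p) (snd p))"
      using e(2) unfolding I_def by force
  qed (auto simp: I_def intro: box_subset_cbox[THEN subsetD])
  obtain \<F> where \<F>: "\<F> \<subseteq> (\<lambda>p. box (fst p) (snd p)) ` I" "countable \<F>" "\<Union>\<F> = U"
    using Lindelof[of "(\<lambda>p. box (fst p) (snd p)) ` I"] U by auto
  then obtain J where J: "J \<subseteq> I" "countable J" "\<F> = (\<lambda>p. box (fst p) (snd p)) ` J"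
    using countable_subset_image[of \<F> "\<lambda>p. box (fst p) (snd p)" I] by auto
  \<comment> \<open>The corners \<open>(1, 0)\<close> describe an empty box; it makes the index set nonempty when \<open>U\<close> is empty.\<close>
  define J' where "J' = insert (1, 0) J"
  have "(1, 0) \<in> I"
    by (auto simp: I_def mem_box_cart dest!: spec[of _ 1])
  hence J': "J' \<subseteq> I" "countable J'" "J' \<noteq> {}"
    using J by (auto simp: J'_def)
  have "U = (\<Union>p\<in>J'. box (fst p) (snd p))"
    using U J' J \<F> by (auto simp: J'_def)
  hence "U = (\<Union>p\<in>range (from_nat_into J'). box (fst p) (snd p))"
    by (simp only: range_from_nat_into[OF J'(3,2)])
  hence "U = (\<Union>n. box (fst (from_nat_into J' n)) (snd (from_nat_into J' n)))"
    by (simp only: image_image)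
  moreover have "cbox (fst (from_nat_into J' n)) (snd (from_nat_into J' n)) \<subseteq> U" for n
    using from_nat_into[OF J'(3), of n] J'(1) by (auto simp: I_def)
  ultimately show thesis
    using that by blast
qed

text \<open>Exhaust \<open>U\<close> by boxes with bumps $b_j$. The functions $1 - \prod_{j<n} (1 - b_j)^n$ have compact
support in the union of the first \<open>n\<close> closed boxes. At a point of the \<open>m\<close>-th box the product is
eventually at most $(1 - b_m)^n$, which tends to \<open>0\<close>; off \<open>U\<close> every factor is \<open>1\<close>.\<close>
lemma smooth_approximation_of_open_set:
  fixes U :: "(real^2) set"
  assumes "open U"
  obtains \<phi> where "\<And>n. \<phi> n \<in> test_fun U" "\<And>n x. cmod (\<phi> n x) \<le> 1"
    "\<And>x. (\<lambda>n. \<phi> n x) \<longlonglongrightarrow> indicator U x"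
proof -
  obtain ab :: "nat \<Rightarrow> (real^2) \<times> (real^2)" where
    sub: "\<And>n. cbox (fst (ab n)) (snd (ab n)) \<subseteq> U" and
    U: "U = (\<Union>n. box (fst (ab n)) (snd (ab n)))"
    by (rule open_Union_boxes[OF assms]) blast
  define P where "P n x = (\<Prod>j<n. (1 - box_bump (ab j) x) ^ n)" for n x
  define \<phi> where "\<phi> n x = complex_of_real (1 - P n x)" for n x
  have P: "0 \<le> P n x" "P n x \<le> 1" for n x
    unfolding P_def
    by (intro prod_nonneg prod_le_1 ballI conjI zero_le_power power_le_one;
        simp add: box_bump_bounds)+
  have "\<phi> n \<in> test_fun U" for n
  proof -
    have "\<phi> n = (\<lambda>x. 1 - (\<Prod>j<n. (1 - complex_of_real (box_bump (ab j) x)) ^ n))"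
      by (auto simp: \<phi>_def P_def)
    also have "\<dots> \<in> flat_algebra"
      by (intro flat_algebra_diff flat_algebra_prod flat_algebra_power box_bump_flat_algebra
          flat_algebra.const)
    finally have "is_Ck m (\<phi> n)" for m
      by (rule flat_algebra_is_Ck)
    moreover have supp: "closure {x. \<phi> n x \<noteq> 0} \<subseteq> (\<Union>j<n. cbox (fst (ab j)) (snd (ab j)))"
    proof (rule closure_minimal)
      show "{x. \<phi> n x \<noteq> 0} \<subseteq> (\<Union>j<n. cbox (fst (ab j)) (snd (ab j)))"
      proof (rule subsetI, rule ccontr)
        fix x assume x: "x \<in> {x. \<phi> n x \<noteq> 0}" "x \<notin> (\<Union>j<n. cbox (fst (ab j)) (snd (ab j)))"
        hence "box_bump (ab j) x = 0" if "j < n" for j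
          using that box_subset_cbox by (intro box_bump_bounds(4)) blast
        with x show False
          by (simp add: \<phi>_def P_def)
      qed
    qed (auto intro: closed_UN)
    moreover have "compact (\<Union>j<n. cbox (fst (ab j)) (snd (ab j)))"
      by (intro compact_UN) auto
    ultimately have "compact (closure {x. \<phi> n x \<noteq> 0})"
      using bounded_subset[OF compact_imp_bounded supp] by (simp add: compact_eq_bounded_closed)
    moreover have "closure {x. \<phi> n x \<noteq> 0} \<subseteq> U"
      using supp sub by blast
    ultimately show ?thesis
      using \<open>\<And>m. is_Ck m (\<phi> n)\<close> by (simp add: test_fun_def)
  qed
  moreover have "cmod (\<phi> n x) \<le> 1" for n x
    using P[where n = n and x = x] by (simp add: \<phi>_def norm_of_real del: of_real_diff)
  moreover have "(\<lambda>n. \<phi> n x) \<longlonglongrightarrow> indicator U x" for x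
  proof (cases "x \<in> U")
    case True
    then obtain m where m: "x \<in> box (fst (ab m)) (snd (ab m))"
      using U by blast
    define q where "q = 1 - box_bump (ab m) x"
    have q: "0 \<le> q" "q < 1"
      using m by (auto simp: q_def box_bump_bounds)
    have "(\<lambda>n. P n x) \<longlonglongrightarrow> 0"
    proof (rule tendsto_sandwich[of "\<lambda>_. 0"])
      show "\<forall>\<^sub>F n in sequentially. P n x \<le> q ^ n"
        using eventually_gt_at_top[of m]
      proof eventually_elim
        case (elim n)
        have "P n x = q ^ n * (\<Prod>j\<in>{..<n} - {m}. (1 - box_bump (ab j) x) ^ n)"
          unfolding P_def q_def using elim by (subst prod.remove[of _ m]) auto
        also have "\<dots> \<le> q ^ n * 1"
          using q by (intro mult_left_mono prod_le_1)
            (auto simp: box_bump_bounds intro!: power_le_one)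
        finally show ?case by simp
      qed
    qed (use P q in \<open>auto intro: LIMSEQ_realpow_zero\<close>)
    hence "(\<lambda>n. \<phi> n x) \<longlonglongrightarrow> complex_of_real (1 - 0)"
      unfolding \<phi>_def by (intro tendsto_intros)
    thus ?thesis
      using True by simp
  next
    case False
    hence "box_bump (ab j) x = 0" for j
      using U by (intro box_bump_bounds(4)) blast
    thus ?thesis
      using False by (simp add: \<phi>_def P_def)
  qed
  ultimately show thesis
    using that by blast
qed

section \<open>The fundamental lemma of the calculus of variations\<close>

text \<open>A compact subset of \<open>{x \<in> S. f x > 0}\<close> is null, because a positive function has integral zero over
it. By inner regularity every bounded part of \<open>{x \<in> S. f x > 0}\<close> is then null.\<close>
lemma AE_nonpos_if_compact_integrals_0:
  fixes f :: "'a::euclidean_space \<Rightarrow> real"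
  assumes S: "S \<in> sets lebesgue" and f: "f \<in> borel_measurable (lebesgue_on S)"
    and int: "\<And>T. compact T \<Longrightarrow> T \<subseteq> S \<Longrightarrow> set_integrable lebesgue T f"
    and zero: "\<And>T. compact T \<Longrightarrow> T \<subseteq> S \<Longrightarrow> (LINT x:T|lebesgue. f x) = 0"
  shows "AE x in lebesgue_on S. f x \<le> 0"
proof -
  define A where "A = {x \<in> S. f x > 0}"
  have A: "A \<in> sets lebesgue"
  proof -
    have "{x \<in> space (lebesgue_on S). f x > 0} \<in> sets (lebesgue_on S)"
      using f by measurable
    thus ?thesis
      using S by (simp add: A_def sets_restrict_space_iff)
  qed
  have null_compact: "T \<in> null_sets lebesgue" if T: "compact T" "T \<subseteq> A" for T
  proof -
    have T': "T \<subseteq> S" "T \<in> sets lebesgue"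
      using T lmeasurable_compact[OF T(1)] by (auto simp: A_def)
    have "AE x in lebesgue. indicator T x *\<^sub>R f x = 0"
    proof (rule integral_nonneg_eq_0_iff_AE[THEN iffD1])
      show "integrable lebesgue (\<lambda>x. indicator T x *\<^sub>R f x)"
        using int[OF T(1) T'(1)] by (simp add: set_integrable_def)
      show "AE x in lebesgue. 0 \<le> indicator T x *\<^sub>R f x"
        using T by (intro AE_I2) (auto simp: A_def indicator_def)
      show "(LINT x|lebesgue. indicator T x *\<^sub>R f x) = 0"
        using zero[OF T(1) T'(1)] by (simp add: set_lebesgue_integral_def)
    qed
    hence "AE x in lebesgue. x \<notin> T"
      by eventually_elim (use T in \<open>auto simp: A_def\<close>)
    thus ?thesis
      using AE_iff_null_sets[OF T'(2)] by blast
  qed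
  have "A \<inter> cball 0 (real n) \<in> null_sets lebesgue" for n
  proof -
    have An: "A \<inter> cball 0 (real n) \<in> sets lebesgue"
      using A by auto
    have le: "emeasure lebesgue (A \<inter> cball 0 (real n)) \<le> 0 + ennreal e" if e: "e > 0" for e
    proof -
      obtain T where T: "closed T" "T \<subseteq> A \<inter> cball 0 (real n)"
        "emeasure lebesgue (A \<inter> cball 0 (real n) - T) < ennreal e"
        using sets_lebesgue_inner_closed[OF An e] by metis
      have "compact T"
        using T(1,2) bounded_subset[OF bounded_cball, of T 0 "real n"]
        by (simp add: compact_eq_bounded_closed)
      hence "T \<in> null_sets lebesgue"
        using T(2) by (intro null_compact) auto
      hence "emeasure lebesgue (A \<inter> cball 0 (real n)) = emeasure lebesgue (A \<inter> cball 0 (real n) - T)"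
        using An by (intro emeasure_Diff_null_set[symmetric])
      thus ?thesis
        using T(3) by (simp add: less_imp_le del: emeasure_completion)
    qed
    have "emeasure lebesgue (A \<inter> cball 0 (real n)) \<le> 0"
      by (rule ennreal_le_epsilon, rule le)
    thus ?thesis
      using An by (auto simp: null_sets_def simp del: emeasure_completion)
  qed
  hence "(\<Union>n. A \<inter> cball 0 (real n)) \<in> null_sets lebesgue"
    by (intro null_sets_UN)
  moreover have "(\<Union>n. A \<inter> cball 0 (real n)) = A"
    using real_arch_simple by auto
  ultimately have "AE x in lebesgue. x \<notin> A"
    by (intro AE_not_in) simp
  hence "AE x in lebesgue. x \<in> S \<longrightarrow> f x \<le> 0"
    by eventually_elim (auto simp: A_def)
  thus ?thesis
    using S by (simp add: AE_restrict_space_iff)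
qed

lemma test_fun_is_Ck: "\<phi> \<in> test_fun \<Omega> \<Longrightarrow> is_Ck n \<phi>"
  unfolding test_fun_def by blast

lemma test_fun_continuous: "\<phi> \<in> test_fun \<Omega> \<Longrightarrow> continuous_on UNIV \<phi>"
  using test_fun_is_Ck[of \<phi> \<Omega> 0] by simp

lemma test_fun_differentiable: "\<phi> \<in> test_fun \<Omega> \<Longrightarrow> \<phi> differentiable (at x)"
  using test_fun_is_Ck[of \<phi> \<Omega> "Suc 0"] by simp

lemma test_fun_continuous_partial_deriv:
  "\<phi> \<in> test_fun \<Omega> \<Longrightarrow> continuous_on UNIV (partial_deriv i \<phi>)"
  using test_fun_is_Ck[of \<phi> \<Omega> "Suc 0"] by simp

text \<open>Approximating indicators by test functions and passing to the limit under the integral gives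
integral zero over bounded open subsets of \<open>\<Omega>\<close>. A compact subset is the difference of two such
sets. The criterion for real functions then applies to the real and imaginary parts of \<open>g\<close>
and to their negatives.\<close>
lemma fundamental_lemma_calculus_of_variations:
  fixes g :: "real^2 \<Rightarrow> complex"
  assumes \<Omega>: "open \<Omega>" and meas: "g \<in> borel_measurable (lebesgue_on \<Omega>)"
    and int: "\<And>r. set_integrable lebesgue (\<Omega> \<inter> ball 0 r) g"
    and zero: "\<And>\<phi>. \<phi> \<in> test_fun \<Omega> \<Longrightarrow> (LINT x|lebesgue_on \<Omega>. g x * \<phi> x) = 0"
  shows "AE x in lebesgue_on \<Omega>. g x = 0"
proof -
  have \<Omega>_sets: "\<Omega> \<in> sets lebesgue"
    using \<Omega> by auto
  have open_int: "set_integrable lebesgue U g \<and> (LINT x:U|lebesgue. g x) = 0"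
    if U: "open U" "U \<subseteq> \<Omega> \<inter> ball 0 r" for U r
  proof -
    have gU: "set_integrable lebesgue U g"
      using U by (intro set_integrable_subset[OF int[of r]]) auto
    \<comment> \<open>The dominating function is \<open>g\<close> cut off to \<open>U\<close>, since the test functions are bounded by \<open>1\<close>.\<close>
    obtain \<phi> where \<phi>: "\<And>n. \<phi> n \<in> test_fun U" "\<And>n x. cmod (\<phi> n x) \<le> 1"
      "\<And>x. (\<lambda>n. \<phi> n x) \<longlonglongrightarrow> indicator U x"
      by (rule smooth_approximation_of_open_set[OF U(1)]) blast
    have supp: "\<phi> n x = 0" if "x \<notin> U" for n x
      using \<phi>(1)[of n] that closure_subset[of "{x. \<phi> n x \<noteq> 0}"] by (auto simp: test_fun_def)
    have meas_\<phi>: "\<phi> n \<in> borel_measurable lebesgue" for n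
      using borel_measurable_continuous_onI[OF test_fun_continuous[OF \<phi>(1)[of n]]]
      by (simp add: measurable_completion)
    have "(\<lambda>n. LINT x|lebesgue. indicator U x *\<^sub>R g x * \<phi> n x)
        \<longlonglongrightarrow> (LINT x|lebesgue. indicator U x *\<^sub>R g x)"
    proof (rule integral_dominated_convergence)
      show "integrable lebesgue (\<lambda>x. norm (indicator U x *\<^sub>R g x))"
        using gU by (intro integrable_norm) (simp add: set_integrable_def)
      show "(\<lambda>x. indicator U x *\<^sub>R g x) \<in> borel_measurable lebesgue"
        using gU by (auto simp: set_integrable_def)
      show "(\<lambda>x. indicator U x *\<^sub>R g x * \<phi> n x) \<in> borel_measurable lebesgue" for n
        using gU meas_\<phi> by (intro borel_measurable_times) (auto simp: set_integrable_def)
      show "AE x in lebesgue. (\<lambda>n. indicator U x *\<^sub>R g x * \<phi> n x) \<longlonglongrightarrow> indicator U x *\<^sub>R g x"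
      proof (intro AE_I2)
        fix x
        have "(\<lambda>n. indicator U x *\<^sub>R g x * \<phi> n x) \<longlonglongrightarrow> indicator U x *\<^sub>R g x * indicator U x"
          by (intro tendsto_intros \<phi>(3))
        thus "(\<lambda>n. indicator U x *\<^sub>R g x * \<phi> n x) \<longlonglongrightarrow> indicator U x *\<^sub>R g x"
          by (cases "x \<in> U") simp_all
      qed
      show "AE x in lebesgue. norm (indicator U x *\<^sub>R g x * \<phi> n x) \<le> norm (indicator U x *\<^sub>R g x)" for n
        using \<phi>(2)[of n] by (intro AE_I2) (simp only: norm_mult mult_right_le_one_le norm_ge_zero)
    qed
    moreover have "(LINT x|lebesgue. indicator U x *\<^sub>R g x * \<phi> n x) = 0" for n
    proof -
      have "(LINT x|lebesgue. indicator U x *\<^sub>R g x * \<phi> n x)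
          = (LINT x|lebesgue. indicator \<Omega> x *\<^sub>R (g x * \<phi> n x))"
        using U supp[of _ n] by (intro Bochner_Integration.integral_cong) (auto simp: indicator_def)
      also have "\<dots> = (LINT x|lebesgue_on \<Omega>. g x * \<phi> n x)"
        using \<Omega>_sets by (subst integral_restrict_space) auto
      also have "\<dots> = 0"
        using \<phi>(1)[of n] U by (intro zero) (auto simp: test_fun_def)
      finally show ?thesis .
    qed
    ultimately show ?thesis
      using gU by (simp add: set_lebesgue_integral_def LIMSEQ_const_iff)
  qed
  have compact_int: "set_integrable lebesgue T g \<and> (LINT x:T|lebesgue. g x) = 0"
    if T: "compact T" "T \<subseteq> \<Omega>" for T
  proof -
    obtain r where r: "T \<subseteq> ball 0 r"
      using compact_imp_bounded[OF T(1)] bounded_subset_ballD by blast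
    define U where "U = \<Omega> \<inter> ball 0 r"
    have U: "open U" "open (U - T)" "U = T \<union> (U - T)"
      using \<Omega> T r by (auto simp: U_def compact_imp_closed intro!: open_Diff)
    have gT: "set_integrable lebesgue T g"
      using T r by (intro set_integrable_subset[OF int[of r]]) (auto intro: fmeasurableD lmeasurable_compact)
    have "(LINT x:T \<union> (U - T)|lebesgue. g x) = (LINT x:T|lebesgue. g x) + (LINT x:U - T|lebesgue. g x)"
      using gT open_int[OF U(2), of r] by (intro set_integral_Un) (auto simp: U_def)
    moreover have "(LINT x:U|lebesgue. g x) = 0" "(LINT x:U - T|lebesgue. g x) = 0"
      using open_int[OF U(1), of r] open_int[OF U(2), of r] by (auto simp: U_def)
    ultimately show ?thesis
      using gT unfolding U(3)[symmetric] by simp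
  qed
  have le: "AE x in lebesgue_on \<Omega>. Re (c * g x) \<le> 0" for c
  proof (rule AE_nonpos_if_compact_integrals_0[OF \<Omega>_sets])
    show "(\<lambda>x. Re (c * g x)) \<in> borel_measurable (lebesgue_on \<Omega>)"
      using meas by measurable
    fix T assume T: "compact T" "T \<subseteq> \<Omega>"
    have "integrable lebesgue (\<lambda>x. indicator T x *\<^sub>R g x)"
      using compact_int[OF T] by (simp add: set_integrable_def)
    hence *: "integrable lebesgue (\<lambda>x. c * (indicator T x *\<^sub>R g x))"
      by (rule integrable_mult_right)
    have eq: "indicator T x *\<^sub>R Re (c * g x) = Re (c * (indicator T x *\<^sub>R g x))" for x
      by (simp add: indicator_def)
    show "set_integrable lebesgue T (\<lambda>x. Re (c * g x))"
      unfolding set_integrable_def eq by (rule integrable_Re[OF *])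
    show "(LINT x:T|lebesgue. Re (c * g x)) = 0"
      unfolding set_lebesgue_integral_def eq integral_Re[OF *]
      unfolding integral_mult_right_zero
      using compact_int[OF T] by (simp add: set_lebesgue_integral_def)
  qed
  show ?thesis
    using le[of 1] le[of "-1"] le[of \<i>] le[of "-\<i>"]
    by eventually_elim (simp add: complex_eq_iff)
qed

section \<open>Square integrable functions\<close>

lemma continuous_imp_measurable_lebesgue_on:
  fixes f :: "real^2 \<Rightarrow> complex"
  shows "continuous_on UNIV f \<Longrightarrow> f \<in> borel_measurable (lebesgue_on \<Omega>)"
  by (intro measurable_restrict_space1 measurable_completion)
      (simp add: borel_measurable_continuous_onI)

lemma test_fun_L2:
  assumes "\<Omega> \<in> sets lebesgue" "\<phi> \<in> test_fun \<Omega>'"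
  shows "\<phi> \<in> L2 \<Omega>"
proof -
  have cont: "continuous_on UNIV \<phi>"
    using assms(2) by (rule test_fun_continuous)
  hence "\<phi> \<in> borel_measurable (lebesgue_on \<Omega>)"
    by (rule continuous_imp_measurable_lebesgue_on)
  moreover have "integrable (lebesgue_on \<Omega>) (\<lambda>x. (cmod (\<phi> x))\<^sup>2)"
  proof -
    let ?K = "closure {x. \<phi> x \<noteq> 0}"
    have "integrable lborel (\<lambda>x. indicator ?K x *\<^sub>R (cmod (\<phi> x))\<^sup>2)"
      using assms cont
      by (intro borel_integrable_compact) (auto simp: test_fun_def intro!: continuous_intros
          intro: continuous_on_subset)
    also have "(\<lambda>x. indicator ?K x *\<^sub>R (cmod (\<phi> x))\<^sup>2) = (\<lambda>x. (cmod (\<phi> x))\<^sup>2)"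
      using closure_subset[of "{x. \<phi> x \<noteq> 0}"] by (auto simp: indicator_def fun_eq_iff)
    finally have "integrable lebesgue (\<lambda>x. (cmod (\<phi> x))\<^sup>2)"
      by (auto simp: integrable_completion)
    thus ?thesis
      using assms integrable_mult_indicator[of \<Omega> lebesgue "\<lambda>x. (cmod (\<phi> x))\<^sup>2"]
      by (simp add: integrable_restrict_space)
  qed
  ultimately show ?thesis
    by (simp add: L2_def)
qed

lemma L2_mult_integrable:
  assumes "u \<in> L2 \<Omega>" "v \<in> L2 \<Omega>"
  shows "integrable (lebesgue_on \<Omega>) (\<lambda>x. u x * v x)"
proof (rule Bochner_Integration.integrable_bound)
  show "integrable (lebesgue_on \<Omega>) (\<lambda>x. (cmod (u x))\<^sup>2 + (cmod (v x))\<^sup>2)"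
    using assms by (auto simp: L2_def)
  show "(\<lambda>x. u x * v x) \<in> borel_measurable (lebesgue_on \<Omega>)"
    using assms by (auto simp: L2_def)
  have "a * b \<le> a\<^sup>2 + b\<^sup>2" for a b :: real
    using sum_squares_bound[of a b] sum_power2_ge_zero[of a b] by linarith
  thus "AE x in lebesgue_on \<Omega>. norm (u x * v x) \<le> norm ((cmod (u x))\<^sup>2 + (cmod (v x))\<^sup>2)"
    by (auto simp: norm_mult)
qed

lemma L2_scale: "u \<in> L2 \<Omega> \<Longrightarrow> (\<lambda>x. c * u x) \<in> L2 \<Omega>"
  by (auto simp: L2_def norm_mult power_mult_distrib)

lemma L2_uminus: "u \<in> L2 \<Omega> \<Longrightarrow> (\<lambda>x. - u x) \<in> L2 \<Omega>"
  using L2_scale[of u \<Omega> "-1"] by simp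

lemma L2_diff:
  assumes "u \<in> L2 \<Omega>" "v \<in> L2 \<Omega>"
  shows "(\<lambda>x. u x - v x) \<in> L2 \<Omega>"
proof -
  have [measurable]: "u \<in> borel_measurable (lebesgue_on \<Omega>)" "v \<in> borel_measurable (lebesgue_on \<Omega>)"
    using assms by (auto simp: L2_def)
  have "integrable (lebesgue_on \<Omega>) (\<lambda>x. (cmod (u x - v x))\<^sup>2)"
  proof (rule Bochner_Integration.integrable_bound)
    show "integrable (lebesgue_on \<Omega>) (\<lambda>x. 2 * (cmod (u x))\<^sup>2 + 2 * (cmod (v x))\<^sup>2)"
      using assms by (auto simp: L2_def)
    have "(cmod (a - b))\<^sup>2 \<le> 2 * (cmod a)\<^sup>2 + 2 * (cmod b)\<^sup>2" for a b
    proof -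
      have "(cmod (a - b))\<^sup>2 \<le> (cmod a + cmod b)\<^sup>2"
        by (intro power_mono norm_triangle_ineq4) auto
      also have "\<dots> \<le> 2 * (cmod a)\<^sup>2 + 2 * (cmod b)\<^sup>2"
        using sum_squares_bound[of "cmod a" "cmod b"] unfolding power2_sum by linarith
      finally show ?thesis .
    qed
    thus "AE x in lebesgue_on \<Omega>. norm ((cmod (u x - v x))\<^sup>2)
        \<le> norm (2 * (cmod (u x))\<^sup>2 + 2 * (cmod (v x))\<^sup>2)"
      by auto
  qed measurable
  thus ?thesis
    by (simp add: L2_def)
qed

text \<open>Square integrable functions are integrable on bounded sets because \<open>a \<le> 1 + a\<^sup>2\<close>.\<close>
lemma L2_orthogonal_to_test_functions:
  assumes \<Omega>: "open \<Omega>" and g: "g \<in> L2 \<Omega>"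
    and zero: "\<And>\<phi>. \<phi> \<in> test_fun \<Omega> \<Longrightarrow> (LINT x|lebesgue_on \<Omega>. g x * \<phi> x) = 0"
  shows "AE x in lebesgue_on \<Omega>. g x = 0"
proof (rule fundamental_lemma_calculus_of_variations[OF \<Omega> _ _ zero])
  show meas: "g \<in> borel_measurable (lebesgue_on \<Omega>)"
    using g by (simp add: L2_def)
  have \<Omega>_sets: "\<Omega> \<in> sets lebesgue"
    using \<Omega> by auto
  show "set_integrable lebesgue (\<Omega> \<inter> ball 0 r) g" for r
    unfolding set_integrable_def
  proof (rule Bochner_Integration.integrable_bound)
    show "integrable lebesgue (\<lambda>x. indicator (ball 0 r) x + indicator \<Omega> x *\<^sub>R (cmod (g x))\<^sup>2)"
    proof (intro Bochner_Integration.integrable_add)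
      show "integrable lebesgue (indicator (ball (0::real^2) r) :: _ \<Rightarrow> real)"
        by (rule lmeasurable_iff_integrable[THEN iffD1, OF lmeasurable_ball])
      show "integrable lebesgue (\<lambda>x. indicator \<Omega> x *\<^sub>R (cmod (g x))\<^sup>2)"
        using g \<Omega>_sets by (simp add: L2_def integrable_restrict_space)
    qed
    have "(\<lambda>x. indicator \<Omega> x *\<^sub>R g x) \<in> borel_measurable lebesgue"
      using meas \<Omega>_sets by (simp add: borel_measurable_restrict_space_iff)
    hence "(\<lambda>x. indicator (ball 0 r) x *\<^sub>R (indicator \<Omega> x *\<^sub>R g x)) \<in> borel_measurable lebesgue"
      by (rule borel_measurable_scaleR[OF borel_measurable_indicator, rotated]) auto
    moreover have "indicator (ball 0 r) x *\<^sub>R (indicator \<Omega> x *\<^sub>R g x)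
        = indicator (\<Omega> \<inter> ball 0 r) x *\<^sub>R g x" for x
      by (auto simp: indicator_def)
    ultimately show "(\<lambda>x. indicator (\<Omega> \<inter> ball 0 r) x *\<^sub>R g x) \<in> borel_measurable lebesgue"
      by (simp only:)
    have "a \<le> 1 + a\<^sup>2" for a :: real
      using sum_squares_bound[of a 1] sum_power2_ge_zero[of a 1]
      unfolding power_one mult_1_right by linarith
    thus "AE x in lebesgue. norm (indicator (\<Omega> \<inter> ball 0 r) x *\<^sub>R g x)
        \<le> norm (indicator (ball 0 r) x + indicator \<Omega> x *\<^sub>R (cmod (g x))\<^sup>2)"
      by (intro AE_I2) (auto simp: indicator_def)
  qed
qed

section \<open>Weak derivatives and traces under a change of sign\<close>

lemma wpartial:
  assumes "u \<in> H1 \<Omega>"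
  shows wpartial_L2: "wpartial \<Omega> i u \<in> L2 \<Omega>"
    and is_weak_partial_wpartial: "is_weak_partial \<Omega> i u (wpartial \<Omega> i u)"
proof -
  have "\<exists>g. g \<in> L2 \<Omega> \<and> is_weak_partial \<Omega> i u g"
    using assms by (auto simp: H1_def)
  from someI_ex[OF this]
  show "wpartial \<Omega> i u \<in> L2 \<Omega>" "is_weak_partial \<Omega> i u (wpartial \<Omega> i u)"
    by (auto simp: wpartial_def)
qed

lemma weak_partial_unique:
  assumes \<Omega>: "open \<Omega>" and L2: "g \<in> L2 \<Omega>" "g' \<in> L2 \<Omega>"
    and "is_weak_partial \<Omega> i u g" "is_weak_partial \<Omega> i u g'"
  shows "AE x in lebesgue_on \<Omega>. g x = g' x"
proof -
  have "AE x in lebesgue_on \<Omega>. g x - g' x = 0"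
  proof (rule L2_orthogonal_to_test_functions[OF \<Omega> L2_diff[OF L2]])
    fix \<phi> assume \<phi>: "\<phi> \<in> test_fun \<Omega>"
    hence "\<phi> \<in> L2 \<Omega>"
      using \<Omega> by (intro test_fun_L2) auto
    moreover have "(LINT x|lebesgue_on \<Omega>. g x * \<phi> x) = (LINT x|lebesgue_on \<Omega>. g' x * \<phi> x)"
      using assms(4,5) \<phi> by (simp add: is_weak_partial_def)
    ultimately show "(LINT x|lebesgue_on \<Omega>. (g x - g' x) * \<phi> x) = 0"
      using L2 by (simp add: left_diff_distrib L2_mult_integrable)
  qed
  thus ?thesis
    by simp
qed

lemma weak_partial_uminus:
  "is_weak_partial \<Omega> i u g \<Longrightarrow> is_weak_partial \<Omega> i (\<lambda>x. - u x) (\<lambda>x. - g x)"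
  by (simp add: is_weak_partial_def)

lemma H1_uminus: "u \<in> H1 \<Omega> \<Longrightarrow> (\<lambda>x. - u x) \<in> H1 \<Omega>"
  unfolding H1_def by (blast intro: L2_uminus weak_partial_uminus)

text \<open>The representatives are chosen separately for \<open>u\<close> and \<open>- u\<close>, so the relation between them comes
from uniqueness and holds only almost everywhere.\<close>
lemma wpartial_uminus:
  assumes "open \<Omega>" "u \<in> H1 \<Omega>"
  shows "AE x in lebesgue_on \<Omega>. wpartial \<Omega> i (\<lambda>x. - u x) x = - wpartial \<Omega> i u x"
  using assms
  by (intro weak_partial_unique[where i = i and u = "\<lambda>x. - u x"] L2_uminus weak_partial_uminus
      wpartial_L2 is_weak_partial_wpartial H1_uminus)

lemma partial_deriv_uminus:
  assumes "f differentiable (at x)"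
  shows "partial_deriv i (\<lambda>x. - f x) x = - partial_deriv i f x"
proof -
  have "((\<lambda>x. - f x) has_derivative (\<lambda>h. - frechet_derivative f (at x) h)) (at x)"
    using assms by (intro has_derivative_minus) (simp add: frechet_derivative_works)
  thus ?thesis
    by (simp add: partial_deriv_def frechet_derivative_at[symmetric])
qed

lemma is_Ck_uminus: "is_Ck n f \<Longrightarrow> is_Ck n (\<lambda>x. - f x)"
proof (induction n arbitrary: f)
  case 0
  thus ?case by (auto intro: continuous_on_minus)
next
  case (Suc n)
  have "partial_deriv i (\<lambda>x. - f x) = (\<lambda>x. - partial_deriv i f x)" for i
    using Suc.prems by (intro ext partial_deriv_uminus) auto
  thus ?case
    using Suc by (auto intro: differentiable_minus)
qed

lemma test_fun_uminus: "\<phi> \<in> test_fun \<Omega> \<Longrightarrow> (\<lambda>x. - \<phi> x) \<in> test_fun \<Omega>"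
  by (simp add: test_fun_def is_Ck_uminus)

text \<open>The measure is built on the Borel sets, whatever values it takes on them.\<close>
lemma continuous_imp_measurable_arclength_on:
  fixes f :: "real^2 \<Rightarrow> complex"
  assumes "continuous_on UNIV f"
  shows "f \<in> borel_measurable (arclength_on \<Gamma>)"
proof -
  have "sets (measure_of UNIV (sets borel) hausdorff1) = sets (borel :: (real^2) measure)"
    using sets.sigma_sets_eq[of "borel :: (real^2) measure"] by simp
  hence "f \<in> borel_measurable (measure_of UNIV (sets borel) hausdorff1)"
    using borel_measurable_continuous_onI[OF assms] by (simp cong: measurable_cong_sets)
  thus ?thesis
    unfolding arclength_on_def by (rule measurable_restrict_space1)
qed

text \<open>This moves boundary values from one side of the boundary to the other: if \<open>u\<close> has trace \<open>h\<close> and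
\<open>g + h\<close> vanishes almost everywhere on the boundary, then \<open>g\<close> itself, and not merely the
function \<open>- h\<close> that agrees with it almost everywhere, is a trace of \<open>- u\<close>. The smooth
approximations of \<open>u\<close>, with their signs changed, serve for \<open>- u\<close>.\<close>
lemma has_trace_uminus:
  assumes \<Omega>: "open \<Omega>" and tr: "has_trace \<Omega> \<Gamma> u h"
    and g: "g \<in> borel_measurable (arclength_on \<Gamma>)"
      "integrable (arclength_on \<Gamma>) (\<lambda>y. (cmod (g y))\<^sup>2)"
    and gh: "AE y in arclength_on \<Gamma>. g y + h y = 0"
  shows "has_trace \<Omega> \<Gamma> (\<lambda>x. - u x) g"
proof -
  from tr obtain \<phi> where u: "u \<in> H1 \<Omega>" and h: "h \<in> borel_measurable (arclength_on \<Gamma>)"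
    and \<phi>: "\<And>n. \<phi> n \<in> test_fun UNIV"
    and L2: "(\<lambda>n. LINT x|lebesgue_on \<Omega>. (cmod (\<phi> n x - u x))\<^sup>2) \<longlonglongrightarrow> 0"
    and grad: "\<And>i. (\<lambda>n. LINT x|lebesgue_on \<Omega>.
          (cmod (partial_deriv i (\<phi> n) x - wpartial \<Omega> i u x))\<^sup>2) \<longlonglongrightarrow> 0"
    and bdry: "(\<lambda>n. LINT y|arclength_on \<Gamma>. (cmod (\<phi> n y - h y))\<^sup>2) \<longlonglongrightarrow> 0"
    unfolding has_trace_def by blast
  have "(LINT x|lebesgue_on \<Omega>. (cmod (- \<phi> n x - - u x))\<^sup>2)
      = (LINT x|lebesgue_on \<Omega>. (cmod (\<phi> n x - u x))\<^sup>2)" for n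
    by (simp add: norm_minus_commute)
  moreover have "(LINT x|lebesgue_on \<Omega>.
        (cmod (partial_deriv i (\<lambda>x. - \<phi> n x) x - wpartial \<Omega> i (\<lambda>x. - u x) x))\<^sup>2)
      = (LINT x|lebesgue_on \<Omega>. (cmod (partial_deriv i (\<phi> n) x - wpartial \<Omega> i u x))\<^sup>2)" for i n
  proof (rule integral_cong_AE)
    have [measurable]: "partial_deriv i (\<phi> n) \<in> borel_measurable (lebesgue_on \<Omega>)"
      "partial_deriv i (\<lambda>x. - \<phi> n x) \<in> borel_measurable (lebesgue_on \<Omega>)"
      "wpartial \<Omega> i u \<in> borel_measurable (lebesgue_on \<Omega>)"
      "wpartial \<Omega> i (\<lambda>x. - u x) \<in> borel_measurable (lebesgue_on \<Omega>)"
      using \<phi>[of n] test_fun_uminus[OF \<phi>[of n]] wpartial_L2[OF u, of i]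
        wpartial_L2[OF H1_uminus[OF u], of i]
      by (auto intro: continuous_imp_measurable_lebesgue_on test_fun_continuous_partial_deriv
          simp: L2_def)
    show "(\<lambda>x. (cmod (partial_deriv i (\<lambda>x. - \<phi> n x) x - wpartial \<Omega> i (\<lambda>x. - u x) x))\<^sup>2)
        \<in> borel_measurable (lebesgue_on \<Omega>)"
      "(\<lambda>x. (cmod (partial_deriv i (\<phi> n) x - wpartial \<Omega> i u x))\<^sup>2)
        \<in> borel_measurable (lebesgue_on \<Omega>)"
      by measurable
    show "AE x in lebesgue_on \<Omega>.
        (cmod (partial_deriv i (\<lambda>x. - \<phi> n x) x - wpartial \<Omega> i (\<lambda>x. - u x) x))\<^sup>2
        = (cmod (partial_deriv i (\<phi> n) x - wpartial \<Omega> i u x))\<^sup>2"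
      using wpartial_uminus[OF \<Omega> u, of i]
      by eventually_elim
        (simp add: partial_deriv_uminus[OF test_fun_differentiable[OF \<phi>]] norm_minus_commute)
  qed
  moreover have "(LINT y|arclength_on \<Gamma>. (cmod (- \<phi> n y - g y))\<^sup>2)
      = (LINT y|arclength_on \<Gamma>. (cmod (\<phi> n y - h y))\<^sup>2)" for n
  proof (rule integral_cong_AE)
    have [measurable]: "\<phi> n \<in> borel_measurable (arclength_on \<Gamma>)"
      by (intro continuous_imp_measurable_arclength_on test_fun_continuous[OF \<phi>])
    show "(\<lambda>y. (cmod (- \<phi> n y - g y))\<^sup>2) \<in> borel_measurable (arclength_on \<Gamma>)"
      "(\<lambda>y. (cmod (\<phi> n y - h y))\<^sup>2) \<in> borel_measurable (arclength_on \<Gamma>)"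
      using g(1) h by measurable
    show "AE y in arclength_on \<Gamma>. (cmod (- \<phi> n y - g y))\<^sup>2 = (cmod (\<phi> n y - h y))\<^sup>2"
      using gh
    proof eventually_elim
      case (elim y)
      hence "h y = - g y"
        by (simp add: add_eq_0_iff)
      thus ?case
        using norm_minus_cancel[of "\<phi> n y + g y"] by simp
    qed
  qed
  ultimately show ?thesis
    unfolding has_trace_def using u g \<phi> L2 grad bdry
    by (intro conjI exI[of _ "\<lambda>n x. - \<phi> n x"]) (auto intro: H1_uminus test_fun_uminus)
qed

section \<open>The energy identity\<close>

definition dirichlet_energy :: "(real^2) set \<Rightarrow> (real^2 \<Rightarrow> complex) \<Rightarrow> real" where
  "dirichlet_energy \<Omega> u = (LINT x|lebesgue_on \<Omega>. (\<Sum>i\<in>UNIV. (cmod (wpartial \<Omega> i u x))\<^sup>2))"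

lemma dirichlet_energy_nonneg: "0 \<le> dirichlet_energy \<Omega> u"
  by (auto simp: dirichlet_energy_def intro!: integral_nonneg_AE sum_nonneg)

lemma grad_inner_self: "grad_inner \<Omega> u u = complex_of_real (dirichlet_energy \<Omega> u)"
proof -
  have "(\<Sum>i\<in>UNIV. wpartial \<Omega> i u x * cnj (wpartial \<Omega> i u x))
      = complex_of_real (\<Sum>i\<in>UNIV. (cmod (wpartial \<Omega> i u x))\<^sup>2)" for x
    unfolding of_real_sum complex_norm_square ..
  thus ?thesis
    unfolding grad_inner_def dirichlet_energy_def by (simp only: integral_complex_of_real)
qed

lemma grad_inner_uminus_right:
  assumes \<Omega>: "open \<Omega>" and u: "u \<in> H1 \<Omega>" and \<psi>: "\<psi> \<in> H1 \<Omega>"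
  shows "grad_inner \<Omega> u (\<lambda>x. - \<psi> x) = - grad_inner \<Omega> u \<psi>"
proof -
  have [measurable]: "wpartial \<Omega> i u \<in> borel_measurable (lebesgue_on \<Omega>)"
    "wpartial \<Omega> i \<psi> \<in> borel_measurable (lebesgue_on \<Omega>)"
    "wpartial \<Omega> i (\<lambda>x. - \<psi> x) \<in> borel_measurable (lebesgue_on \<Omega>)" for i
    using wpartial_L2[OF u] wpartial_L2[OF \<psi>] wpartial_L2[OF H1_uminus[OF \<psi>]]
    by (auto simp: L2_def)
  have [measurable]: "cnj \<in> borel_measurable borel"
    by (intro borel_measurable_continuous_onI continuous_intros)
  have "AE x in lebesgue_on \<Omega>. \<forall>i\<in>UNIV. wpartial \<Omega> i (\<lambda>x. - \<psi> x) x = - wpartial \<Omega> i \<psi> x"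
    by (intro AE_finite_allI wpartial_uminus[OF \<Omega> \<psi>]) auto
  hence "grad_inner \<Omega> u (\<lambda>x. - \<psi> x)
      = (LINT x|lebesgue_on \<Omega>. - (\<Sum>i\<in>UNIV. wpartial \<Omega> i u x * cnj (wpartial \<Omega> i \<psi> x)))"
    unfolding grad_inner_def
    by (intro integral_cong_AE) (measurable, auto simp: sum_negf elim!: eventually_mono)
  thus ?thesis
    by (simp add: grad_inner_def)
qed

lemma l2_inner_self:
  "l2_inner \<Omega> (\<lambda>x. c * u x) u = c * complex_of_real (LINT x|lebesgue_on \<Omega>. (cmod (u x))\<^sup>2)"
proof -
  have "c * u x * cnj (u x) = c * complex_of_real ((cmod (u x))\<^sup>2)" for x
    unfolding complex_norm_square by (rule mult.assoc)
  thus ?thesis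
    unfolding l2_inner_def by (simp only: integral_mult_right_zero integral_complex_of_real)
qed

lemma l2_inner_uminus_right: "l2_inner \<Omega> u (\<lambda>x. - \<psi> x) = - l2_inner \<Omega> u \<psi>"
  by (simp add: l2_inner_def)

text \<open>With zero energy the weak gradient vanishes almost everywhere, so the weak equation says that \<open>f\<close>
is orthogonal to all test functions.\<close>
lemma laplacian_0_if_dirichlet_energy_0:
  assumes \<Omega>: "open \<Omega>" and lap: "has_weak_laplacian \<Omega> u f" and "dirichlet_energy \<Omega> u = 0"
  shows "AE x in lebesgue_on \<Omega>. f x = 0"
proof (rule L2_orthogonal_to_test_functions[OF \<Omega>])
  have u: "u \<in> H1 \<Omega>"
    using lap by (simp add: has_weak_laplacian_def)
  show "f \<in> L2 \<Omega>"
    using lap by (simp add: has_weak_laplacian_def)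
  have "AE x in lebesgue_on \<Omega>. (\<Sum>i\<in>UNIV. (cmod (wpartial \<Omega> i u x))\<^sup>2) = 0"
    using wpartial_L2[OF u] assms(3)
    by (subst integral_nonneg_eq_0_iff_AE[symmetric])
      (auto simp: dirichlet_energy_def L2_def intro!: sum_nonneg)
  hence grad: "AE x in lebesgue_on \<Omega>. \<forall>i. wpartial \<Omega> i u x = 0"
    by eventually_elim (subst (asm) sum_nonneg_eq_0_iff, auto)
  fix \<phi> assume \<phi>: "\<phi> \<in> test_fun \<Omega>"
  have "AE x in lebesgue_on \<Omega>. (\<Sum>i\<in>UNIV. wpartial \<Omega> i u x * partial_deriv i \<phi> x) = 0"
    using grad by eventually_elim simp
  hence "(LINT x|lebesgue_on \<Omega>. (\<Sum>i\<in>UNIV. wpartial \<Omega> i u x * partial_deriv i \<phi> x)) = 0"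
    by (rule integral_eq_zero_AE)
  thus "(LINT x|lebesgue_on \<Omega>. f x * \<phi> x) = 0"
    using lap \<phi> by (simp add: has_weak_laplacian_def)
qed

theorem lemma3p2:
  fixes D :: "(real^2) set" and k :: complex
  assumes "bounded_analytic_region D"
    and "k \<in> C_plus"
    and "transmission_eigenvalue D k"
  shows "k \<in> \<real>"
proof (rule ccontr)
  assume "k \<notin> \<real>"
  with \<open>k \<in> C_plus\<close> have Im_k2: "Im (k\<^sup>2) \<noteq> 0" and "k \<noteq> 0"
    by (auto simp: C_plus_def complex_is_Real_iff power2_eq_square)
  define E where "E = exterior_of D"
  have D: "open D" and E: "open E"
    using assms(1) by (auto simp: bounded_analytic_region_def E_def)
  from assms(3) obtain v w Nv Nw where
    X: "(v, w) \<in> X_space D" and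
    nontrivial: "\<not> ((AE x in lebesgue_on D. v x = 0) \<and> (AE x in lebesgue_on E. w x = 0))" and
    lap_v: "has_weak_laplacian D v (\<lambda>x. - k\<^sup>2 * v x)" and
    lap_w: "has_weak_laplacian E w (\<lambda>x. k\<^sup>2 * w x)" and
    Nv: "has_normal_derivative D (frontier D) v (\<lambda>x. - k\<^sup>2 * v x) Nv" and
    Nw: "has_normal_derivative E (frontier D) w (\<lambda>x. k\<^sup>2 * w x) Nw" and
    N: "\<And>\<psi> g. has_trace D (frontier D) \<psi> g \<Longrightarrow> Nv g + (- Nw g) = 0"
    unfolding transmission_eigenvalue_def E_def by blast
  from X obtain g h where
    tr_v: "has_trace D (frontier D) v g" and tr_w: "has_trace E (frontier D) w h" and
    gh: "AE y in arclength_on (frontier D). g y + h y = 0"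
    unfolding X_space_def E_def by blast
  have w: "w \<in> H1 E"
    using tr_w by (simp add: has_trace_def)
  \<comment> \<open>Both normal derivatives are evaluated at the same function \<open>g\<close>, using \<open>v\<close> inside and \<open>- w\<close> outside.\<close>
  have tr_w': "has_trace E (frontier D) (\<lambda>x. - w x) g"
    using tr_v by (intro has_trace_uminus[OF E tr_w _ _ gh]) (auto simp: has_trace_def)
  define V where "V = (LINT x|lebesgue_on D. (cmod (v x))\<^sup>2)"
  define W where "W = (LINT x|lebesgue_on E. (cmod (w x))\<^sup>2)"
  have "Nv g = complex_of_real (dirichlet_energy D v) - k\<^sup>2 * V"
    using Nv tr_v l2_inner_self[of D "- k\<^sup>2" v]
    by (simp add: has_normal_derivative_def grad_inner_self V_def)
  moreover have "Nw g = - complex_of_real (dirichlet_energy E w) - k\<^sup>2 * W"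
    using Nw tr_w' l2_inner_self[of E "k\<^sup>2" w]
    by (simp add: has_normal_derivative_def grad_inner_uminus_right[OF E w w] grad_inner_self
        l2_inner_uminus_right W_def)
  ultimately have energy:
    "complex_of_real (dirichlet_energy D v + dirichlet_energy E w) = k\<^sup>2 * complex_of_real (V - W)"
    using N[OF tr_v] unfolding of_real_add of_real_diff by algebra
  have "Im (k\<^sup>2 * complex_of_real (V - W)) = 0"
    by (metis energy Im_complex_of_real)
  hence "V - W = 0"
    using Im_k2 by simp
  hence "complex_of_real (dirichlet_energy D v + dirichlet_energy E w) = 0"
    using energy by simp
  hence "dirichlet_energy D v + dirichlet_energy E w = 0"
    by (simp only: of_real_eq_0_iff)
  hence "dirichlet_energy D v = 0" "dirichlet_energy E w = 0"
    using dirichlet_energy_nonneg[of D v] dirichlet_energy_nonneg[of E w] by linarith+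
  hence "AE x in lebesgue_on D. v x = 0" "AE x in lebesgue_on E. w x = 0"
    using laplacian_0_if_dirichlet_energy_0[OF D lap_v] laplacian_0_if_dirichlet_energy_0[OF E lap_w]
      \<open>k \<noteq> 0\<close> by simp_all
  with nontrivial show False
    by blast
qed

end
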